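(* For every integer $n\ge 1$, the Lie algebra $\mathfrak D(n)$ is a naturally graded nilpotent Lie algebra, with $$\dim \mathfrak D(n)=\begin{cases}6m,& n=4m,\\ 6m+2,& n=4m+1,\\ 6m+3,& n=4m+2,\\ 6m+5,& n=4m+3,\end{cases}\qquad s(\mathfrak D(n))=n .$$
   Context: $\mathfrak D(n)=\bigoplus_{l=1}^n\mathfrak D_l$ is the positively graded real Lie algebra defined as follows. For odd $l\le n$, $\mathfrak D_l$ is two-dimensional with basis $v_l,u_l$; for even $l\le n$, $\mathfrak D_l$ is one-dimensional with basis $w_l$. For odd positive $i,l\le n$ and even positive $j\le n$ the brackets are $$[v_i,w_j]=u_{i+j}\ \text{if } i+j\le n,\quad [w_j,u_l]=v_{j+l}\ \text{if } j+l\le n,\quad [u_l,v_i]=w_{l+i}\ \text{if } l+i\le n,$$ each of these brackets being zero if the resulting index exceeds $n$; all other brackets of basis elements not determined by antisymmetry are zero. The descending central series of a Lie algebra $\mathfrak g$ is $\mathfrak g^1=\mathfrak g$, $\mathfrak g^k=[\mathfrak g,\mathfrak g^{k-1}]$. The nil-index $s(\mathfrak g)$ of a nilpotent Lie algebra is the natural number with $\mathfrak g^{s(\mathfrak g)}\neq0$, $\mathfrak g^{s(\mathfrak g)+1}=0$. A nilpotent Lie algebra $\mathfrak g$ is naturally graded if it is isomorphic, as a graded Lie algebra, to its associated graded Lie algebra $\bigoplus_{i\ge1}\mathfrak g^i/\mathfrak g^{i+1}$ with respect to the descending central series; here the grading on $\mathfrak D(n)$ is $\bigoplus_l\mathfrak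 D_l$. *)

theory Defs
  imports "Jordan_Normal_Form.VS_Connect" "HOL-Algebra.AbelCoset"
begin

record ('k, 'a) lie_algebra = "('k, 'a) module" +
  bracket :: "'a \<Rightarrow> 'a \<Rightarrow> 'a"

(* The ring-valued fields mult and one of a module record carry no meaning for a Lie algebra. *)
locale lie_algebra = vectorspace K L for K :: "('k, 'r) ring_scheme" (structure)
    and L :: "('k, 'a, 'm) lie_algebra_scheme" (structure) +
  assumes bracket_closed:
      "\<lbrakk>x \<in> carrier L; y \<in> carrier L\<rbrakk> \<Longrightarrow> bracket L x y \<in> carrier L"
    and bracket_add_left:
      "\<lbrakk>x \<in> carrier L; y \<in> carrier L; z \<in> carrier L\<rbrakk>
        \<Longrightarrow> bracket L (x \<oplus>\<^bsub>L\<^esub> y) z = bracket L x z \<oplus>\<^bsub>L\<^esub> bracket L y z"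
    and bracket_add_right:
      "\<lbrakk>x \<in> carrier L; y \<in> carrier L; z \<in> carrier L\<rbrakk>
        \<Longrightarrow> bracket L x (y \<oplus>\<^bsub>L\<^esub> z) = bracket L x y \<oplus>\<^bsub>L\<^esub> bracket L x z"
    and bracket_smult_left:
      "\<lbrakk>c \<in> carrier K; x \<in> carrier L; y \<in> carrier L\<rbrakk>
        \<Longrightarrow> bracket L (c \<odot>\<^bsub>L\<^esub> x) y = c \<odot>\<^bsub>L\<^esub> bracket L x y"
    and bracket_smult_right:
      "\<lbrakk>c \<in> carrier K; x \<in> carrier L; y \<in> carrier L\<rbrakk>
        \<Longrightarrow> bracket L x (c \<odot>\<^bsub>L\<^esub> y) = c \<odot>\<^bsub>L\<^esub> bracket L x y"
    and bracket_self: "x \<in> carrier L \<Longrightarrow> bracket L x x = \<zero>\<^bsub>L\<^esub>"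
    and jacobi:
      "\<lbrakk>x \<in> carrier L; y \<in> carrier L; z \<in> carrier L\<rbrakk>
        \<Longrightarrow> bracket L x (bracket L y z) \<oplus>\<^bsub>L\<^esub> bracket L y (bracket L z x)
            \<oplus>\<^bsub>L\<^esub> bracket L z (bracket L x y) = \<zero>\<^bsub>L\<^esub>"

definition bracket_space ::
    "('k, 'r) ring_scheme \<Rightarrow> ('k, 'a, 'm) lie_algebra_scheme \<Rightarrow> 'a set \<Rightarrow> 'a set \<Rightarrow> 'a set" where
  "bracket_space K L A B = LinearCombinations.module.span K L {bracket L a b | a b. a \<in> A \<and> b \<in> B}"

(* The series is indexed from 1; the value at 0 is padding, chosen equal to the value at 1,
   so that the quotient of term 0 by term 1 is trivial. *)
fun lower_central ::
    "('k, 'r) ring_scheme \<Rightarrow> ('k, 'a, 'm) lie_algebra_scheme \<Rightarrow> nat \<Rightarrow> 'a set" where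
  "lower_central K L 0 = carrier L"
| "lower_central K L (Suc 0) = carrier L"
| "lower_central K L (Suc (Suc k)) = bracket_space K L (carrier L) (lower_central K L (Suc k))"

definition nilpotent_lie_algebra ::
    "('k, 'r) ring_scheme \<Rightarrow> ('k, 'a, 'm) lie_algebra_scheme \<Rightarrow> bool" where
  "nilpotent_lie_algebra K L \<longleftrightarrow>
     lie_algebra K L \<and> (\<exists>k\<ge>1. lower_central K L k = {\<zero>\<^bsub>L\<^esub>})"

definition nil_index ::
    "('k, 'r) ring_scheme \<Rightarrow> ('k, 'a, 'm) lie_algebra_scheme \<Rightarrow> nat" where
  "nil_index K L = (THE s. s \<ge> 1 \<and> lower_central K L s \<noteq> {\<zero>\<^bsub>L\<^esub>} \<and>
                           lower_central K L (s + 1) = {\<zero>\<^bsub>L\<^esub>})"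

(* Positive gradings: the homogeneous components are G 1, G 2, ..., and G 0 is trivial. *)
locale graded_lie_algebra = lie_algebra K L for K :: "('k, 'r) ring_scheme" (structure)
    and L :: "('k, 'a, 'm) lie_algebra_scheme" (structure) +
  fixes G :: "nat \<Rightarrow> 'a set"
  assumes component_0: "G 0 = {\<zero>\<^bsub>L\<^esub>}"
    and component_subspace: "VectorSpace.subspace K (G i) L"
    and direct_sum: "x \<in> carrier L \<Longrightarrow>
      \<exists>!f. (\<forall>i. f i \<in> G i) \<and> finite {i. f i \<noteq> \<zero>\<^bsub>L\<^esub>} \<and>
           x = (\<Oplus>\<^bsub>L\<^esub>i\<in>{i. f i \<noteq> \<zero>\<^bsub>L\<^esub>}. f i)"
    and component_bracket: "\<lbrakk>x \<in> G i; y \<in> G j\<rbrakk> \<Longrightarrow> bracket L x y \<in> G (i + j)"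

definition graded_lie_iso ::
    "('k, 'r) ring_scheme \<Rightarrow> ('k, 'a, 'm) lie_algebra_scheme \<Rightarrow> (nat \<Rightarrow> 'a set) \<Rightarrow>
     ('k, 'b, 'n) lie_algebra_scheme \<Rightarrow> (nat \<Rightarrow> 'b set) \<Rightarrow> ('a \<Rightarrow> 'b) \<Rightarrow> bool" where
  "graded_lie_iso K L G M H \<phi> \<longleftrightarrow>
     \<phi> \<in> LinearCombinations.module_hom K L M \<and> bij_betw \<phi> (carrier L) (carrier M) \<and>
     (\<forall>x\<in>carrier L. \<forall>y\<in>carrier L. \<phi> (bracket L x y) = bracket M (\<phi> x) (\<phi> y)) \<and>
     (\<forall>i. \<phi> ` G i = H i)"

(* The union collapses to the single coset of c x, for any representative x of A. *)
definition quotient_space ::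
    "('k, 'a, 'm) module_scheme \<Rightarrow> 'a set \<Rightarrow> ('k, 'a set) module" where
  "quotient_space V W = \<lparr>carrier = a_rcosets\<^bsub>V\<^esub> W, mult = (\<lambda>_ _. W), one = W, zero = W,
     add = set_add V, smult = (\<lambda>c A. \<Union>x\<in>A. W +>\<^bsub>V\<^esub> (c \<odot>\<^bsub>V\<^esub> x))\<rparr>"

definition lcs_quotient ::
    "('k, 'r) ring_scheme \<Rightarrow> ('k, 'a, 'm) lie_algebra_scheme \<Rightarrow> nat \<Rightarrow> ('k, 'a set) module" where
  "lcs_quotient K L i =
     quotient_space (L\<lparr>carrier := lower_central K L i\<rparr>) (lower_central K L (Suc i))"

(* The bracket of a coset in degree i with a coset in degree j, a coset in degree i + j;
   again the union collapses to the coset of [x, y] for any representatives x, y. *)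
definition lcs_quotient_bracket ::
    "('k, 'r) ring_scheme \<Rightarrow> ('k, 'a, 'm) lie_algebra_scheme \<Rightarrow> nat \<Rightarrow> nat \<Rightarrow>
     'a set \<Rightarrow> 'a set \<Rightarrow> 'a set" where
  "lcs_quotient_bracket K L i j A B =
     (\<Union>x\<in>A. \<Union>y\<in>B. lower_central K L (Suc (i + j)) +>\<^bsub>L\<^esub> bracket L x y)"

(* Elements of the external direct sum are the finitely supported families of cosets. *)
definition assoc_graded ::
    "('k, 'r) ring_scheme \<Rightarrow> ('k, 'a, 'm) lie_algebra_scheme \<Rightarrow>
     ('k, nat \<Rightarrow> 'a set) lie_algebra" where
  "assoc_graded K L =
     \<lparr>carrier = {F. (\<forall>i. F i \<in> carrier (lcs_quotient K L i)) \<and>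
                    finite {i. F i \<noteq> \<zero>\<^bsub>lcs_quotient K L i\<^esub>}},
      mult = (\<lambda>_ _ i. \<zero>\<^bsub>lcs_quotient K L i\<^esub>),
      one = (\<lambda>i. \<zero>\<^bsub>lcs_quotient K L i\<^esub>),
      zero = (\<lambda>i. \<zero>\<^bsub>lcs_quotient K L i\<^esub>),
      add = (\<lambda>F G i. F i \<oplus>\<^bsub>lcs_quotient K L i\<^esub> G i),
      smult = (\<lambda>c F i. c \<odot>\<^bsub>lcs_quotient K L i\<^esub> F i),
      bracket = (\<lambda>F G k. \<Oplus>\<^bsub>lcs_quotient K L k\<^esub>i\<in>{1..<k}.
                   lcs_quotient_bracket K L i (k - i) (F i) (G (k - i)))\<rparr>"

definition assoc_graded_component ::
    "('k, 'r) ring_scheme \<Rightarrow> ('k, 'a, 'm) lie_algebra_scheme \<Rightarrow> nat \<Rightarrow>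
     (nat \<Rightarrow> 'a set) set" where
  "assoc_graded_component K L i =
     {F \<in> carrier (assoc_graded K L). \<forall>j. j \<noteq> i \<longrightarrow> F j = \<zero>\<^bsub>lcs_quotient K L j\<^esub>}"

definition naturally_graded ::
    "('k, 'r) ring_scheme \<Rightarrow> ('k, 'a, 'm) lie_algebra_scheme \<Rightarrow> (nat \<Rightarrow> 'a set) \<Rightarrow> bool" where
  "naturally_graded K L G \<longleftrightarrow>
     nilpotent_lie_algebra K L \<and> graded_lie_algebra K L G \<and>
     (\<exists>\<phi>. graded_lie_iso K L G (assoc_graded K L) (assoc_graded_component K L) \<phi>)"

datatype D_index = Dv nat | Du nat | Dw nat

fun D_degree :: "D_index \<Rightarrow> nat" where
  "D_degree (Dv l) = l"
| "D_degree (Du l) = l"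
| "D_degree (Dw l) = l"

definition D_basis :: "nat \<Rightarrow> D_index set" where
  "D_basis n = {Dv l | l. odd l \<and> l \<le> n} \<union> {Du l | l. odd l \<and> l \<le> n} \<union>
               {Dw l | l. even l \<and> 1 \<le> l \<and> l \<le> n}"

(* A vector is its coordinate function with respect to D_basis n. This is the basis vector of
   index b, and zero when b is not in D_basis n, in particular when its degree exceeds n. *)
definition D_vec :: "nat \<Rightarrow> D_index \<Rightarrow> D_index \<Rightarrow> real" where
  "D_vec n b = (\<lambda>c. if c = b \<and> b \<in> D_basis n then 1 else 0)"

fun D_basis_bracket :: "nat \<Rightarrow> D_index \<Rightarrow> D_index \<Rightarrow> D_index \<Rightarrow> real" where
  "D_basis_bracket n (Dv i) (Dw j) = D_vec n (Du (i + j))"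
| "D_basis_bracket n (Dw j) (Dv i) = (\<lambda>c. - D_vec n (Du (i + j)) c)"
| "D_basis_bracket n (Dw j) (Du l) = D_vec n (Dv (j + l))"
| "D_basis_bracket n (Du l) (Dw j) = (\<lambda>c. - D_vec n (Dv (j + l)) c)"
| "D_basis_bracket n (Du l) (Dv i) = D_vec n (Dw (l + i))"
| "D_basis_bracket n (Dv i) (Du l) = (\<lambda>c. - D_vec n (Dw (l + i)) c)"
| "D_basis_bracket n _ _ = (\<lambda>_. 0)"

definition D_algebra :: "nat \<Rightarrow> (real, D_index \<Rightarrow> real) lie_algebra" where
  "D_algebra n =
     \<lparr>carrier = {x. \<forall>b. b \<notin> D_basis n \<longrightarrow> x b = 0},
      mult = (\<lambda>_ _ _. 0), one = (\<lambda>_. 0), zero = (\<lambda>_. 0),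
      add = (\<lambda>x y b. x b + y b),
      smult = (\<lambda>c x b. c * x b),
      bracket = (\<lambda>x y c. \<Sum>a\<in>D_basis n. \<Sum>b\<in>D_basis n. x a * y b * D_basis_bracket n a b c)\<rparr>"

definition D_component :: "nat \<Rightarrow> nat \<Rightarrow> (D_index \<Rightarrow> real) set" where
  "D_component n l = {x \<in> carrier (D_algebra n). \<forall>b. x b \<noteq> 0 \<longrightarrow> D_degree b = l}"

end

(* Collecting the coordinates of x along v_i, u_i and w_i into three formal power series turns the
   bracket of D(n) into the cross product of R[[t]]^3, truncated above degree n; the Jacobi identity
   is that of the cross product. A basis vector of degree k + 1 >= 2 is, up to sign, the bracket of
   v_1 or u_1 with a basis vector of degree k. Hence the k-th term of the descending central series
   is the sum of the components of degree at least k, and sending x to the family of the cosets of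
   its homogeneous components is an isomorphism onto the associated graded algebra. *)
theory Submission
  imports Defs "HOL-Computational_Algebra.Formal_Power_Series"
begin

text \<open>In the frame (u, v, w) the brackets are those of the cross product, so D(n) sits in
  so(3) tensored with truncated polynomials in t: u and v carry odd powers, w even powers. Parities
  are respected because odd + even is odd and odd + odd is even, so the index restrictions can be
  encoded purely by vanishing coordinates. Truncation does no harm to the Jacobi identity, since
  coefficient k of a product of power series depends only on coefficients up to k. The other
  obstacle is the associated graded algebra, whose operations are unions over representatives of
  cosets. Each coset is therefore described as the set of vectors with prescribed coordinates up to
  some degree; well-definedness then becomes a comparison of coordinates. Homogeneity of the
  structure constants drives all of this: the filtration, the grading and the bracket on
  cosets.\<close>

lemma D_algebra_simps [simp]:
  "x \<oplus>\<^bsub>D_algebra n\<^esub> y = (\<lambda>b. x b + y b)"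
  "\<zero>\<^bsub>D_algebra n\<^esub> = (\<lambda>_. 0)"
  "c \<odot>\<^bsub>D_algebra n\<^esub> x = (\<lambda>b. c * x b)"
  by (simp_all add: D_algebra_def)

lemma carrier_D_algebra: "carrier (D_algebra n) = {x. \<forall>b. b \<notin> D_basis n \<longrightarrow> x b = 0}"
  by (simp add: D_algebra_def)

lemma bracket_D_algebra:
  "bracket (D_algebra n) x y c =
     (\<Sum>a\<in>D_basis n. \<Sum>b\<in>D_basis n. x a * y b * D_basis_bracket n a b c)"
  by (simp add: D_algebra_def)

lemma mem_D_basis [simp]:
  "Dv l \<in> D_basis n \<longleftrightarrow> odd l \<and> l \<le> n"
  "Du l \<in> D_basis n \<longleftrightarrow> odd l \<and> l \<le> n"
  "Dw l \<in> D_basis n \<longleftrightarrow> even l \<and> 1 \<le> l \<and> l \<le> n"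
  by (auto simp: D_basis_def)

lemma D_degree_basis:
  assumes "b \<in> D_basis n"
  shows "1 \<le> D_degree b" "D_degree b \<le> n"
  using assms by (cases b; auto elim: oddE)+

lemma D_basis_eq:
  "D_basis n = Dv ` {l. odd l \<and> l \<le> n} \<union> Du ` {l. odd l \<and> l \<le> n} \<union>
     Dw ` {l. even l \<and> 1 \<le> l \<and> l \<le> n}"
  by (auto simp: D_basis_def)

lemma finite_D_basis [simp]: "finite (D_basis n)"
  unfolding D_basis_eq by auto

lemma sum_D_basis:
  assumes "x \<in> carrier (D_algebra n)"
  shows "(\<Sum>a\<in>D_basis n. x a * f a) =
     (\<Sum>i\<le>n. x (Dv i) * f (Dv i)) + (\<Sum>i\<le>n. x (Du i) * f (Du i)) + (\<Sum>i\<le>n. x (Dw i) * f (Dw i))"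
proof -
  let ?A = "Dv ` {..n}" and ?B = "Du ` {..n}" and ?C = "Dw ` {..n}"
  have "(\<Sum>a\<in>D_basis n. x a * f a) = (\<Sum>a\<in>(?A \<union> ?B) \<union> ?C. x a * f a)"
    using assms by (intro sum.mono_neutral_left) (auto simp: D_basis_eq carrier_D_algebra)
  also have "\<dots> = (\<Sum>a\<in>?A. x a * f a) + (\<Sum>a\<in>?B. x a * f a) + (\<Sum>a\<in>?C. x a * f a)"
    by (subst sum.union_disjoint; auto)+
  finally show ?thesis
    by (simp add: sum.reindex inj_on_def)
qed

lemma D_vec_eq_0: "b \<notin> D_basis n \<Longrightarrow> D_vec n b c = 0"
  by (simp add: D_vec_def)

text \<open>Homogeneity of the structure constants, the source of every later statement about
  degrees of brackets.\<close>

lemma D_basis_bracket_nonzero: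
  assumes "D_basis_bracket n a b c \<noteq> 0"
  shows "c \<in> D_basis n" "D_degree c = D_degree a + D_degree b"
  using assms by (cases a; cases b; auto simp: D_vec_def split: if_splits)+

lemma D_basis_bracket_antisym: "D_basis_bracket n b a c = - D_basis_bracket n a b c"
  by (cases a; cases b; simp add: add.commute)

section \<open>The bracket through power series, and the Jacobi identity\<close>

definition fps_v :: "(D_index \<Rightarrow> real) \<Rightarrow> real fps" where "fps_v x = Abs_fps (\<lambda>i. x (Dv i))"
definition fps_u :: "(D_index \<Rightarrow> real) \<Rightarrow> real fps" where "fps_u x = Abs_fps (\<lambda>i. x (Du i))"
definition fps_w :: "(D_index \<Rightarrow> real) \<Rightarrow> real fps" where "fps_w x = Abs_fps (\<lambda>i. x (Dw i))"

lemmas fps_vuw_defs = fps_v_def fps_u_def fps_w_def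

text \<open>The bound \<open>k \<le> n\<close> places the whole antidiagonal
  \<open>i + j = k\<close> inside the square of indices up to \<open>n\<close>, so the double sum is
  a full Cauchy product coefficient.\<close>

lemma fps_mult_nth_square:
  assumes "k \<le> n"
  shows "(\<Sum>i\<le>n. \<Sum>j\<le>n. if i + j = k then f i * g j else 0) = fps_nth (Abs_fps f * Abs_fps g) k"
proof -
  have "(\<Sum>j\<le>n. if i + j = k then f i * g j else 0) = (if i \<le> k then f i * g (k - i) else 0)" for i
  proof (cases "i \<le> k")
    case True
    then have "(i + j = k) = (j = k - i)" for j by auto
    with True assms show ?thesis by auto
  qed auto
  then have "(\<Sum>i\<le>n. \<Sum>j\<le>n. if i + j = k then f i * g j else 0) =
      (\<Sum>i\<le>n. if i \<le> k then f i * g (k - i) else 0)" by simp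
  also have "\<dots> = (\<Sum>i\<in>{0..k}. f i * g (k - i))"
    using assms by (intro sum.mono_neutral_cong_right) auto
  finally show ?thesis by (simp add: fps_mult_nth)
qed

lemma bracket_expand:
  assumes "x \<in> carrier (D_algebra n)" "y \<in> carrier (D_algebra n)"
  shows "bracket (D_algebra n) x y c =
    (\<Sum>i\<le>n. \<Sum>j\<le>n. x (Dv i) * y (Dw j) * D_vec n (Du (i + j)) c) -
    (\<Sum>i\<le>n. \<Sum>j\<le>n. x (Dw i) * y (Dv j) * D_vec n (Du (i + j)) c) +
    (\<Sum>i\<le>n. \<Sum>j\<le>n. x (Dw i) * y (Du j) * D_vec n (Dv (i + j)) c) -
    (\<Sum>i\<le>n. \<Sum>j\<le>n. x (Du i) * y (Dw j) * D_vec n (Dv (i + j)) c) +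
    (\<Sum>i\<le>n. \<Sum>j\<le>n. x (Du i) * y (Dv j) * D_vec n (Dw (i + j)) c) -
    (\<Sum>i\<le>n. \<Sum>j\<le>n. x (Dv i) * y (Du j) * D_vec n (Dw (i + j)) c)"
proof -
  have "bracket (D_algebra n) x y c =
     (\<Sum>a\<in>D_basis n. x a * (\<Sum>b\<in>D_basis n. y b * D_basis_bracket n a b c))"
    by (simp add: bracket_D_algebra sum_distrib_left mult.assoc)
  also have "\<dots> = (\<Sum>i\<le>n. x (Dv i) * (\<Sum>b\<in>D_basis n. y b * D_basis_bracket n (Dv i) b c)) +
      (\<Sum>i\<le>n. x (Du i) * (\<Sum>b\<in>D_basis n. y b * D_basis_bracket n (Du i) b c)) +
      (\<Sum>i\<le>n. x (Dw i) * (\<Sum>b\<in>D_basis n. y b * D_basis_bracket n (Dw i) b c))"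
    by (rule sum_D_basis[OF assms(1)])
  finally show ?thesis
    unfolding sum_D_basis[OF assms(2)]
    by (simp add: sum_distrib_left sum.distrib sum_negf sum_subtractf distrib_left right_diff_distrib
        add.commute mult.assoc)
qed

text \<open>The right-hand sides are the components of the cross product in the ordered frame (u, v,
  w).\<close>

lemma bracket_fps:
  assumes xy: "x \<in> carrier (D_algebra n)" "y \<in> carrier (D_algebra n)" and "k \<le> n"
  shows "bracket (D_algebra n) x y (Dv k) = fps_nth (fps_w x * fps_u y - fps_u x * fps_w y) k"
    and "bracket (D_algebra n) x y (Du k) = fps_nth (fps_v x * fps_w y - fps_w x * fps_v y) k"
    and "bracket (D_algebra n) x y (Dw k) = fps_nth (fps_u x * fps_v y - fps_v x * fps_u y) k"
proof -
  \<comment> \<open>Here \<open>D_vec\<close> acts as the Kronecker delta of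
    \<open>i + j = k\<close>. It could differ from it only where \<open>r (i + j)\<close> leaves the
    basis; by the second premise the sum then exceeds \<open>n\<close>, hence is not
    \<open>k\<close>, or one of the two coordinates is zero.\<close>
  have conv: "(\<Sum>i\<le>n. \<Sum>j\<le>n. x (p i) * y (q j) * D_vec n (r (i + j)) (r k)) =
      fps_nth (Abs_fps (\<lambda>i. x (p i)) * Abs_fps (\<lambda>i. y (q i))) k"
    if "inj r" "\<And>i j. p i \<in> D_basis n \<Longrightarrow> q j \<in> D_basis n \<Longrightarrow> i + j \<le> n \<Longrightarrow> r (i + j) \<in> D_basis n" for p q r
    unfolding fps_mult_nth_square[OF \<open>k \<le> n\<close>, symmetric]
  proof (intro sum.cong refl)
    fix i j
    show "x (p i) * y (q j) * D_vec n (r (i + j)) (r k) =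
        (if i + j = k then x (p i) * y (q j) else 0)"
      using that(2)[of i j] xy \<open>k \<le> n\<close> inj_eq[OF that(1), of k "i + j"]
      by (auto simp: carrier_D_algebra D_vec_def)
  qed
  have inj: "inj Dv" "inj Du" "inj Dw" by (auto simp: inj_def)
  \<comment> \<open>These six triples are the ones occurring in \<open>bracket_expand\<close>; their
    parities add up correctly, which discharges the second premise of \<open>conv\<close>.\<close>
  have conv_vwu: "(\<Sum>i\<le>n. \<Sum>j\<le>n. x (p i) * y (q j) * D_vec n (r (i + j)) (r k)) =
      fps_nth (Abs_fps (\<lambda>i. x (p i)) * Abs_fps (\<lambda>i. y (q i))) k"
    if "(r, p, q) \<in> {(Dv, Dw, Du), (Dv, Du, Dw), (Du, Dv, Dw), (Du, Dw, Dv), (Dw, Du, Dv), (Dw, Dv, Du)}"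
    for p q r
    using that inj by (intro conv) (auto simp: Suc_le_eq odd_pos)
  have zero: "D_vec n (Dv l) (Du k) = 0" "D_vec n (Dv l) (Dw k) = 0" "D_vec n (Du l) (Dv k) = 0"
    "D_vec n (Du l) (Dw k) = 0" "D_vec n (Dw l) (Dv k) = 0" "D_vec n (Dw l) (Du k) = 0" for l
    by (simp_all add: D_vec_def)
  show "bracket (D_algebra n) x y (Dv k) = fps_nth (fps_w x * fps_u y - fps_u x * fps_w y) k"
    by (simp add: bracket_expand xy zero fps_vuw_defs conv_vwu)
  show "bracket (D_algebra n) x y (Du k) = fps_nth (fps_v x * fps_w y - fps_w x * fps_v y) k"
    by (simp add: bracket_expand xy zero fps_vuw_defs conv_vwu)
  show "bracket (D_algebra n) x y (Dw k) = fps_nth (fps_u x * fps_v y - fps_v x * fps_u y) k"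
    by (simp add: bracket_expand xy zero fps_vuw_defs conv_vwu)
qed

lemma bracket_D_closed: "bracket (D_algebra n) x y \<in> carrier (D_algebra n)"
proof -
  have "D_basis_bracket n a b c = 0" if "c \<notin> D_basis n" for a b c
    using D_basis_bracket_nonzero(1) that by blast
  then show ?thesis by (auto simp: carrier_D_algebra bracket_D_algebra)
qed

text \<open>This is why truncation is harmless: an inner bracket agrees with the untruncated product
  up to degree \<open>n\<close>, and no higher coefficient enters.\<close>

lemma fps_mult_nth_cong:
  fixes f g h :: "'a::semiring_1 fps"
  assumes "\<And>i. i \<le> k \<Longrightarrow> fps_nth g i = fps_nth h i"
  shows "fps_nth (f * g) k = fps_nth (f * h) k"
  by (simp add: fps_mult_nth assms)

text \<open>These are the components of the untruncated double cross product of x with the cross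
  product of y and z, valid in degrees up to \<open>n\<close>.\<close>

lemma bracket_fps_iterated:
  assumes x: "x \<in> carrier (D_algebra n)" and y: "y \<in> carrier (D_algebra n)"
    and z: "z \<in> carrier (D_algebra n)" and k: "k \<le> n"
  shows "bracket (D_algebra n) x (bracket (D_algebra n) y z) (Dv k) =
      fps_nth (fps_w x * (fps_v y * fps_w z - fps_w y * fps_v z)
             - fps_u x * (fps_u y * fps_v z - fps_v y * fps_u z)) k"
    and "bracket (D_algebra n) x (bracket (D_algebra n) y z) (Du k) =
      fps_nth (fps_v x * (fps_u y * fps_v z - fps_v y * fps_u z)
             - fps_w x * (fps_w y * fps_u z - fps_u y * fps_w z)) k"
    and "bracket (D_algebra n) x (bracket (D_algebra n) y z) (Dw k) =
      fps_nth (fps_u x * (fps_w y * fps_u z - fps_u y * fps_w z)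
             - fps_v x * (fps_v y * fps_w z - fps_w y * fps_v z)) k"
proof -
  let ?b = "bracket (D_algebra n) y z"
  have "fps_nth (f * fps_v ?b) k = fps_nth (f * (fps_w y * fps_u z - fps_u y * fps_w z)) k"
    "fps_nth (f * fps_u ?b) k = fps_nth (f * (fps_v y * fps_w z - fps_w y * fps_v z)) k"
    "fps_nth (f * fps_w ?b) k = fps_nth (f * (fps_u y * fps_v z - fps_v y * fps_u z)) k" for f
    using k by (intro fps_mult_nth_cong; simp add: fps_vuw_defs(1)[of ?b] fps_vuw_defs(2)[of ?b]
        fps_vuw_defs(3)[of ?b] bracket_fps y z)+
  then show "bracket (D_algebra n) x ?b (Dv k) =
      fps_nth (fps_w x * (fps_v y * fps_w z - fps_w y * fps_v z)
             - fps_u x * (fps_u y * fps_v z - fps_v y * fps_u z)) k"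
    and "bracket (D_algebra n) x ?b (Du k) =
      fps_nth (fps_v x * (fps_u y * fps_v z - fps_v y * fps_u z)
             - fps_w x * (fps_w y * fps_u z - fps_u y * fps_w z)) k"
    and "bracket (D_algebra n) x ?b (Dw k) =
      fps_nth (fps_u x * (fps_w y * fps_u z - fps_u y * fps_w z)
             - fps_v x * (fps_v y * fps_w z - fps_w y * fps_v z)) k"
    by (simp_all only: bracket_fps[OF x bracket_D_closed k] fps_sub_nth)
qed

lemma jacobi_D_algebra:
  assumes x: "x \<in> carrier (D_algebra n)" and y: "y \<in> carrier (D_algebra n)"
    and z: "z \<in> carrier (D_algebra n)"
  shows "bracket (D_algebra n) x (bracket (D_algebra n) y z) c +
    bracket (D_algebra n) y (bracket (D_algebra n) z x) c +
    bracket (D_algebra n) z (bracket (D_algebra n) x y) c = 0"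
proof (cases "c \<in> D_basis n")
  case False
  then show ?thesis using bracket_D_closed by (simp add: carrier_D_algebra)
next
  case True
  \<comment> \<open>The identity is checked once in the commutative ring of power series and then
    read off coefficientwise, so no Cauchy product is unfolded.\<close>
  have *: "fps_nth a k + fps_nth b k + fps_nth c k = 0" if "a + b + c = 0"
    for a b c :: "real fps" and k
    using arg_cong[OF that, of "\<lambda>f. fps_nth f k"] by simp
  show ?thesis
  proof (cases c)
    case (Dv k)
    then have "k \<le> n" using True by simp
    then show ?thesis unfolding Dv
      by (simp only: bracket_fps_iterated x y z) (rule *, simp add: algebra_simps)
  next
    case (Du k)
    then have "k \<le> n" using True by simp
    then show ?thesis unfolding Du
      by (simp only: bracket_fps_iterated x y z) (rule *, simp add: algebra_simps)
  next
    case (Dw k)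
    then have "k \<le> n" using True by simp
    then show ?thesis unfolding Dw
      by (simp only: bracket_fps_iterated x y z) (rule *, simp add: algebra_simps)
  qed
qed

section \<open>Vector space and Lie algebra structure\<close>

lemma vectorspace_D_algebra: "vectorspace (class_ring :: real ring) (D_algebra n)"
proof -
  have "abelian_group (D_algebra n)"
  proof (rule abelian_groupI)
    fix x assume "x \<in> carrier (D_algebra n)"
    then show "\<exists>y\<in>carrier (D_algebra n). y \<oplus>\<^bsub>D_algebra n\<^esub> x = \<zero>\<^bsub>D_algebra n\<^esub>"
      by (intro bexI[of _ "\<lambda>b. - x b"]) (auto simp: carrier_D_algebra)
  qed (auto simp: carrier_D_algebra add_ac)
  then have "Module.module (class_ring :: real ring) (D_algebra n)"
    by (intro moduleI)
      (auto simp: carrier_D_algebra algebra_simps class_cring.is_cring intro: class_cring.cring_axioms)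
  then show ?thesis
    by (simp add: vectorspace_def class_field)
qed

interpretation D: vectorspace "class_ring :: real ring" "D_algebra n" for n
  by (rule vectorspace_D_algebra)

lemma lie_algebra_D_algebra: "lie_algebra (class_ring :: real ring) (D_algebra n)"
proof
  fix x y z :: "D_index \<Rightarrow> real"
  assume "x \<in> carrier (D_algebra n)" "y \<in> carrier (D_algebra n)" "z \<in> carrier (D_algebra n)"
  then show "bracket (D_algebra n) x (bracket (D_algebra n) y z) \<oplus>\<^bsub>D_algebra n\<^esub>
      bracket (D_algebra n) y (bracket (D_algebra n) z x) \<oplus>\<^bsub>D_algebra n\<^esub>
      bracket (D_algebra n) z (bracket (D_algebra n) x y) = \<zero>\<^bsub>D_algebra n\<^esub>"
    by (simp add: jacobi_D_algebra)
next
  fix x :: "D_index \<Rightarrow> real"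
  \<comment> \<open>Antisymmetry of the structure constants, after exchanging the two summations,
    shows that [x, x] is its own negative; over the reals it is therefore zero.\<close>
  have "bracket (D_algebra n) x x c = - bracket (D_algebra n) x x c" for c
  proof -
    have "bracket (D_algebra n) x x c =
        (\<Sum>a\<in>D_basis n. \<Sum>b\<in>D_basis n. x b * x a * D_basis_bracket n b a c)"
      unfolding bracket_D_algebra by (rule sum.swap)
    also have "\<dots> = - bracket (D_algebra n) x x c"
      unfolding bracket_D_algebra
      by (subst D_basis_bracket_antisym) (simp add: sum_negf mult.commute)
    finally show ?thesis .
  qed
  then have "bracket (D_algebra n) x x c = 0" for c
    by (metis eq_neg_iff_add_eq_0 mult_2 mult_eq_0_iff zero_neq_numeral)
  then show "bracket (D_algebra n) x x = \<zero>\<^bsub>D_algebra n\<^esub>" by auto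
qed (auto simp: bracket_D_closed bracket_D_algebra fun_eq_iff algebra_simps sum.distrib
    sum_distrib_left)

section \<open>The degree filtration and the descending central series\<close>

definition D_filtration :: "nat \<Rightarrow> nat \<Rightarrow> (D_index \<Rightarrow> real) set" where
  "D_filtration n k = {x \<in> carrier (D_algebra n). \<forall>b. D_degree b < k \<longrightarrow> x b = 0}"

definition D_proj :: "nat \<Rightarrow> (D_index \<Rightarrow> real) \<Rightarrow> D_index \<Rightarrow> real" where
  "D_proj i x = (\<lambda>b. if D_degree b = i then x b else 0)"

lemma D_vec_carrier [simp]: "D_vec n b \<in> carrier (D_algebra n)"
  by (auto simp: carrier_D_algebra D_vec_def)

text \<open>For an infinite index set both sums default to zero, so evaluation at a coordinate
  commutes with every such sum.\<close>

lemma finsum_D_algebra: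
  assumes "f \<in> A \<rightarrow> carrier (D_algebra n)"
  shows "(\<Oplus>\<^bsub>D_algebra n\<^esub>i\<in>A. f i) = (\<lambda>b. \<Sum>i\<in>A. f i b)"
  using assms
  by (induction A rule: infinite_finite_induct) (auto simp: D.finsum_infinite D.finsum_insert)

lemma submoduleI_D:
  assumes "N \<subseteq> carrier (D_algebra n)" "(\<lambda>_. 0) \<in> N"
    "\<And>x y. x \<in> N \<Longrightarrow> y \<in> N \<Longrightarrow> (\<lambda>b. x b + y b) \<in> N"
    "\<And>c x. x \<in> N \<Longrightarrow> (\<lambda>b. c * x b) \<in> N"
  shows "submodule (class_ring :: real ring) N (D_algebra n)"
  using assms D.module_axioms by (intro submodule.intro) auto

lemma submodule_D_filtration: "submodule (class_ring :: real ring) (D_filtration n k) (D_algebra n)"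
  by (rule submoduleI_D) (auto simp: D_filtration_def carrier_D_algebra)

lemma D_vec_expansion:
  assumes "x \<in> carrier (D_algebra n)"
  shows "(\<Oplus>\<^bsub>D_algebra n\<^esub>b\<in>D_basis n. x b \<odot>\<^bsub>D_algebra n\<^esub> D_vec n b) = x"
proof -
  have *: "x b * D_vec n b c = (if c = b then x c else 0)" if "b \<in> D_basis n" for b c
    using that by (simp add: D_vec_def)
  have "(\<Oplus>\<^bsub>D_algebra n\<^esub>b\<in>D_basis n. x b \<odot>\<^bsub>D_algebra n\<^esub> D_vec n b) =
      (\<lambda>c. \<Sum>b\<in>D_basis n. x b * D_vec n b c)"
    by (subst finsum_D_algebra) (auto simp: carrier_D_algebra D_vec_eq_0 D_vec_def)
  also have "\<dots> = x"
    using assms by (auto simp: * carrier_D_algebra)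
  finally show ?thesis .
qed

lemma finsum_submodule_closed:
  assumes "submodule (class_ring :: real ring) N (D_algebra n)" "\<And>i. i \<in> A \<Longrightarrow> f i \<in> N"
  shows "(\<Oplus>\<^bsub>D_algebra n\<^esub>i\<in>A. f i) \<in> N"
  using assms(2)
proof (induction A rule: infinite_finite_induct)
  case (insert i A)
  then show ?case
    using submodule.subset[OF assms(1)] submodule.m_closed[OF assms(1)]
    by (subst D.finsum_insert) blast+
qed (use submodule.zero_closed[OF assms(1)] in \<open>simp_all add: D.finsum_infinite\<close>)

lemma bracket_D_vec:
  assumes "a \<in> D_basis n" "b \<in> D_basis n"
  shows "bracket (D_algebra n) (D_vec n a) (D_vec n b) = D_basis_bracket n a b"
proof
  fix c
  have *: "D_vec n a a' * D_vec n b b' * r = (if a' = a then if b' = b then r else 0 else 0)"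
    for a' b' r
    using assms by (simp add: D_vec_def)
  show "bracket (D_algebra n) (D_vec n a) (D_vec n b) c = D_basis_bracket n a b c"
    unfolding bracket_D_algebra * using assms
    by (subst sum.swap) (simp add: sum.delta)
qed

text \<open>Explicitly, v_l = -[u_1, w_(l-1)], u_l = [v_1, w_(l-1)] and w_l = [u_1, v_(l-1)]. The
  scalar -1 arises because the table lists the first of these brackets with w on the left.\<close>

lemma D_vec_bracket:
  assumes "b \<in> D_basis n" "D_degree b = Suc (Suc k)"
  shows "\<exists>a\<in>D_basis n. \<exists>b'\<in>D_basis n. \<exists>c. D_degree b' = Suc k \<and>
    D_vec n b = c \<odot>\<^bsub>D_algebra n\<^esub> bracket (D_algebra n) (D_vec n a) (D_vec n b')"
proof (cases b)
  case (Dv l)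
  with assms show ?thesis
    by (intro bexI[of _ "Du 1"] bexI[of _ "Dw (Suc k)"] exI[of _ "-1"]) (auto simp: bracket_D_vec)
next
  case (Du l)
  with assms show ?thesis
    by (intro bexI[of _ "Dv 1"] bexI[of _ "Dw (Suc k)"] exI[of _ "1"]) (auto simp: bracket_D_vec)
next
  case (Dw l)
  with assms show ?thesis
    by (intro bexI[of _ "Du 1"] bexI[of _ "Dv (Suc k)"] exI[of _ "1"]) (auto simp: bracket_D_vec)
qed

text \<open>A nonzero term contributing in degree below \<open>i + j\<close> would need a factor of
  degree below \<open>i\<close> or below \<open>j\<close>, where \<open>x\<close> or
  \<open>y\<close> vanishes.\<close>

lemma bracket_D_filtration:
  assumes "x \<in> D_filtration n i" "y \<in> D_filtration n j"
  shows "bracket (D_algebra n) x y \<in> D_filtration n (i + j)"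
proof -
  have "x a * y b * D_basis_bracket n a b c = 0" if "D_degree c < i + j" for a b c
  proof (rule ccontr)
    assume nz: "x a * y b * D_basis_bracket n a b c \<noteq> 0"
    then have "D_degree c = D_degree a + D_degree b" by (auto dest: D_basis_bracket_nonzero)
    with that have "D_degree a < i \<or> D_degree b < j" by linarith
    with assms nz show False by (auto simp: D_filtration_def)
  qed
  then show ?thesis using bracket_D_closed by (simp add: D_filtration_def bracket_D_algebra)
qed

lemma D_filtration_1: "D_filtration n (Suc 0) = carrier (D_algebra n)"
  using D_degree_basis(1) by (fastforce simp: D_filtration_def carrier_D_algebra)

lemma D_filtration_0: "D_filtration n 0 = carrier (D_algebra n)"
  by (simp add: D_filtration_def)

lemma D_filtration_Suc_Suc:
  "bracket_space (class_ring :: real ring) (D_algebra n) (carrier (D_algebra n)) (D_filtration n (Suc k)) =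
     D_filtration n (Suc (Suc k))" (is "bracket_space _ _ _ _ = ?F")
proof -
  define S where "S = {bracket (D_algebra n) a b |a b. a \<in> carrier (D_algebra n) \<and> b \<in> D_filtration n (Suc k)}"
  \<comment> \<open>The whole algebra is the filtration term of index 1, which is what raises the
    degree by one.\<close>
  have S: "S \<subseteq> ?F" unfolding S_def
    using bracket_D_filtration[of _ n "Suc 0" _ "Suc k"] by (auto simp: D_filtration_1)
  have sub: "submodule class_ring (D.span n S) (D_algebra n)"
    using S by (intro D.span_is_submodule) (auto simp: D_filtration_def)
  have S_span: "S \<subseteq> D.span n S"
    using S by (intro D.in_own_span) (auto simp: D_filtration_def)
  have "?F \<subseteq> D.span n S"
  proof
    fix x assume x: "x \<in> ?F"
    have "x b \<odot>\<^bsub>D_algebra n\<^esub> D_vec n b \<in> D.span n S" if b: "b \<in> D_basis n" for b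
    proof (cases "D_degree b < Suc (Suc k)")
      case True
      then have "x b = 0" using x by (simp add: D_filtration_def)
      then show ?thesis using submodule.zero_closed[OF sub] by simp
    next
      case False
      \<comment> \<open>The degree may exceed \<open>Suc (Suc k)\<close>. Lowering it by one still
        leaves at least \<open>Suc k\<close>, so the second factor stays in the filtration term and
        the bracket belongs to \<open>S\<close>.\<close>
      then obtain d where d: "D_degree b = Suc (Suc (k + d))"
        by (metis add_Suc le_Suc_ex not_less)
      from D_vec_bracket[OF b this] obtain a b' c
        where *: "b' \<in> D_basis n" "D_degree b' = Suc (k + d)"
          "D_vec n b = c \<odot>\<^bsub>D_algebra n\<^esub> bracket (D_algebra n) (D_vec n a) (D_vec n b')"
        by blast
      have "D_vec n b' \<in> D_filtration n (Suc k)"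
        using *(1,2) D_vec_carrier[of n b'] by (auto simp: D_filtration_def D_vec_def)
      then have "bracket (D_algebra n) (D_vec n a) (D_vec n b') \<in> S"
        unfolding S_def using D_vec_carrier by blast
      then have "bracket (D_algebra n) (D_vec n a) (D_vec n b') \<in> D.span n S"
        using S_span by blast
      then show ?thesis
        unfolding *(3) by (intro submodule.smult_closed[OF sub]) simp_all
    qed
    then have "(\<Oplus>\<^bsub>D_algebra n\<^esub>b\<in>D_basis n. x b \<odot>\<^bsub>D_algebra n\<^esub> D_vec n b) \<in> D.span n S"
      by (rule finsum_submodule_closed[OF sub])
    then show "x \<in> D.span n S"
      using x by (simp add: D_vec_expansion D_filtration_def del: D_algebra_simps)
  qed
  moreover have "D.span n S \<subseteq> ?F"
    using S submodule_D_filtration by (rule D.span_is_subset)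
  ultimately show ?thesis
    unfolding bracket_space_def S_def by blast
qed

text \<open>Terms 0 and 1 of the filtration both equal the whole algebra, as degrees start at 1;
  this matches the padding of \<open>lower_central\<close> at index 0.\<close>

lemma lower_central_D_algebra:
  "lower_central (class_ring :: real ring) (D_algebra n) k = D_filtration n k"
proof (induction k)
  case (Suc k)
  then show ?case by (cases k) (simp_all only: lower_central.simps D_filtration_1 D_filtration_Suc_Suc)
qed (simp add: D_filtration_0)

lemma D_filtration_trivial_iff:
  assumes "1 \<le> n"
  shows "D_filtration n k = {\<lambda>_. 0} \<longleftrightarrow> n < k"
proof
  assume "n < k"
  then have "x b = 0" if "x \<in> D_filtration n k" for x b
    using that D_degree_basis(2)[of b n] by (cases "b \<in> D_basis n") (auto simp: D_filtration_def carrier_D_algebra)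
  then have "x = (\<lambda>_. 0)" if "x \<in> D_filtration n k" for x
    using that by blast
  moreover have "(\<lambda>_. 0) \<in> D_filtration n k"
    by (simp add: D_filtration_def carrier_D_algebra)
  ultimately show "D_filtration n k = {\<lambda>_. 0}" by blast
next
  assume *: "D_filtration n k = {\<lambda>_. 0}"
  show "n < k"
  proof (rule ccontr)
    assume "\<not> n < k"
    \<comment> \<open>A basis vector of top degree \<open>n\<close> exists for either parity, and it
      lies in every filtration term of index at most \<open>n\<close>.\<close>
    define b where "b = (if odd n then Dv n else Dw n)"
    have "b \<in> D_basis n" "D_degree b = n" using assms by (auto simp: b_def)
    then have "D_vec n b \<in> D_filtration n k" "D_vec n b b \<noteq> 0"
      using \<open>\<not> n < k\<close> D_vec_carrier[of n b] by (auto simp: D_filtration_def D_vec_def)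
    with * show False by auto
  qed
qed

lemma nilpotent_D_algebra:
  assumes "1 \<le> n"
  shows "nilpotent_lie_algebra (class_ring :: real ring) (D_algebra n)"
  using assms D_filtration_trivial_iff[OF assms, of "Suc n"]
  by (auto simp: nilpotent_lie_algebra_def lie_algebra_D_algebra lower_central_D_algebra intro!: exI[of _ "Suc n"])

lemma nil_index_D_algebra:
  assumes "1 \<le> n"
  shows "nil_index (class_ring :: real ring) (D_algebra n) = n"
  unfolding nil_index_def lower_central_D_algebra
  using assms by (intro the_equality) (auto simp: D_filtration_trivial_iff)

section \<open>Basis and dimension\<close>

lemma inj_on_D_vec: "inj_on (D_vec n) (D_basis n)"
proof (rule inj_onI)
  fix a b assume ab: "a \<in> D_basis n" "D_vec n a = D_vec n b"
  then have "D_vec n b a = 1" by (metis D_vec_def)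
  then show "a = b" by (auto simp: D_vec_def split: if_splits)
qed

text \<open>Evaluation at \<open>b\<close> acts as the dual functional of \<open>D_vec n b\<close>;
  linear independence follows at once.\<close>

lemma lincomb_D_vec:
  assumes "b \<in> D_basis n"
  shows "D.lincomb n a (D_vec n ` D_basis n) b = a (D_vec n b)"
proof -
  have *: "a (D_vec n b') * D_vec n b' b = (if b' = b then a (D_vec n b) else 0)" if "b' \<in> D_basis n" for b'
    using that by (auto simp: D_vec_def)
  have "D.lincomb n a (D_vec n ` D_basis n) =
      (\<lambda>c. \<Sum>v\<in>D_vec n ` D_basis n. (a v \<odot>\<^bsub>D_algebra n\<^esub> v) c)"
    unfolding D.lincomb_def by (rule finsum_D_algebra) (auto intro!: D.smult_closed simp del: D_algebra_simps)
  then show ?thesis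
    using assms by (simp add: sum.reindex inj_on_D_vec * sum.delta)
qed

lemma basis_D_algebra: "D.basis n (D_vec n ` D_basis n)"
proof -
  have "D.lin_indpt n (D_vec n ` D_basis n)"
  proof (rule D.finite_lin_indpt2)
    fix a assume "D.lincomb n a (D_vec n ` D_basis n) = \<zero>\<^bsub>D_algebra n\<^esub>"
    then show "\<forall>v\<in>D_vec n ` D_basis n. a v = \<zero>\<^bsub>class_ring\<^esub>"
      using lincomb_D_vec[of _ n a] by auto
  qed auto
  moreover have "D.span n (D_vec n ` D_basis n) = carrier (D_algebra n)"
  proof
    show "D.span n (D_vec n ` D_basis n) \<subseteq> carrier (D_algebra n)"
      by (rule D.span_is_subset2) auto
    have sub: "submodule class_ring (D.span n (D_vec n ` D_basis n)) (D_algebra n)"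
      by (rule D.span_is_submodule) auto
    have "D_vec n ` D_basis n \<subseteq> D.span n (D_vec n ` D_basis n)"
      by (rule D.in_own_span) auto
    then have span: "(\<Oplus>\<^bsub>D_algebra n\<^esub>b\<in>D_basis n. x b \<odot>\<^bsub>D_algebra n\<^esub> D_vec n b)
        \<in> D.span n (D_vec n ` D_basis n)" for x
      by (intro finsum_submodule_closed[OF sub] submodule.smult_closed[OF sub])
        (simp_all add: image_subset_iff del: D_algebra_simps)
    show "carrier (D_algebra n) \<subseteq> D.span n (D_vec n ` D_basis n)"
    proof
      fix x assume x: "x \<in> carrier (D_algebra n)"
      show "x \<in> D.span n (D_vec n ` D_basis n)"
        using span[of x] unfolding D_vec_expansion[OF x] .
    qed
  qed
  moreover have "D_vec n ` D_basis n \<subseteq> carrier (D_algebra n)" by auto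
  ultimately show ?thesis unfolding D.basis_def by (intro conjI)
qed

lemma fin_dim_D_algebra: "D.fin_dim n"
  using basis_D_algebra unfolding D.fin_dim_def D.basis_def
  by (intro exI[of _ "D_vec n ` D_basis n"]) auto

text \<open>There are \<open>(n + 1) div 2\<close> odd degrees carrying two vectors each and
  \<open>n div 2\<close> positive even degrees carrying one. This single form yields all four
  residues of \<open>n\<close> modulo 4.\<close>

lemma dim_D_algebra: "D.dim n = 2 * ((n + 1) div 2) + n div 2"
proof -
  have odd: "{l. odd l \<and> l \<le> n} = (\<lambda>i. 2 * i + 1) ` {..<(n + 1) div 2}"
    by (auto elim!: oddE)
  have even: "{l. even l \<and> 1 \<le> l \<and> l \<le> n} = (\<lambda>i. 2 * i) ` {1..n div 2}"
    by (auto elim!: evenE)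
  have "card (D_basis n) = 2 * ((n + 1) div 2) + n div 2"
    unfolding D_basis_eq odd even
    by (subst card_Un_disjoint; auto simp: card_image inj_on_def)+
  then show ?thesis
    using D.dim_basis[OF _ basis_D_algebra] by (simp add: card_image inj_on_D_vec)
qed

section \<open>The grading by degree\<close>

lemma D_component_carrier: "x \<in> D_component n i \<Longrightarrow> x \<in> carrier (D_algebra n)"
  by (simp add: D_component_def)

lemma D_component_apply: "x \<in> D_component n i \<Longrightarrow> D_degree b \<noteq> i \<Longrightarrow> x b = 0"
  by (auto simp: D_component_def)

lemma D_proj_component: "x \<in> carrier (D_algebra n) \<Longrightarrow> D_proj i x \<in> D_component n i"
  by (auto simp: D_component_def D_proj_def carrier_D_algebra)

lemma D_component_subset_filtration: "D_component n i \<subseteq> D_filtration n i"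
  by (auto simp: D_component_def D_filtration_def)

text \<open>At coordinate \<open>b\<close> only the summand of index \<open>D_degree b\<close> can
  contribute. The resulting diagonal formula gives both existence and uniqueness of the homogeneous
  decomposition.\<close>

lemma finsum_components:
  assumes f: "\<And>i. f i \<in> D_component n i" and fin: "finite {i. f i \<noteq> (\<lambda>_. 0)}"
  shows "(\<Oplus>\<^bsub>D_algebra n\<^esub>i\<in>{i. f i \<noteq> (\<lambda>_. 0)}. f i) = (\<lambda>b. f (D_degree b) b)"
proof -
  have "(\<Sum>i\<in>{i. f i \<noteq> (\<lambda>_. 0)}. f i b) = f (D_degree b) b" for b
  proof -
    have "f i b = (if i = D_degree b then f (D_degree b) b else 0)" for i
      using D_component_apply[OF f, of b i] by auto
    then have "(\<Sum>i\<in>{i. f i \<noteq> (\<lambda>_. 0)}. f i b) =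
        (\<Sum>i\<in>{i. f i \<noteq> (\<lambda>_. 0)}. if i = D_degree b then f (D_degree b) b else 0)"
      by (intro sum.cong refl)
    then show ?thesis
      using fin by (auto simp: sum.delta)
  qed
  then show ?thesis
    using D_component_carrier[OF f] by (simp add: finsum_D_algebra)
qed

lemma graded_D_algebra: "graded_lie_algebra (class_ring :: real ring) (D_algebra n) (D_component n)"
proof (intro graded_lie_algebra.intro graded_lie_algebra_axioms.intro lie_algebra_D_algebra)
  show "D_component n 0 = {\<zero>\<^bsub>D_algebra n\<^esub>}"
    using D_degree_basis(1) by (fastforce simp: D_component_def carrier_D_algebra)
  show "VectorSpace.subspace class_ring (D_component n i) (D_algebra n)" for i
    by (intro VectorSpace.subspace.intro vectorspace_D_algebra submoduleI_D)
      (auto simp: D_component_def carrier_D_algebra, metis add.right_neutral)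
  show "\<exists>!f. (\<forall>i. f i \<in> D_component n i) \<and> finite {i. f i \<noteq> \<zero>\<^bsub>D_algebra n\<^esub>} \<and>
      x = (\<Oplus>\<^bsub>D_algebra n\<^esub>i\<in>{i. f i \<noteq> \<zero>\<^bsub>D_algebra n\<^esub>}. f i)"
    if x: "x \<in> carrier (D_algebra n)" for x
    unfolding D_algebra_simps
  proof (intro ex1I conjI)
    show comp: "\<forall>i. D_proj i x \<in> D_component n i"
      using x by (simp add: D_proj_component)
    have "D_proj i x = (\<lambda>_. 0)" if "i > n" for i
    proof
      fix b
      show "D_proj i x b = 0"
        using x that D_degree_basis(2)[of b n]
        by (cases "b \<in> D_basis n") (auto simp: D_proj_def carrier_D_algebra)
    qed
    then have "{i. D_proj i x \<noteq> (\<lambda>_. 0)} \<subseteq> {..n}"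
      using not_le by blast
    then show fin: "finite {i. D_proj i x \<noteq> (\<lambda>_. 0)}"
      using finite_atMost by (rule finite_subset)
    show "x = (\<Oplus>\<^bsub>D_algebra n\<^esub>i\<in>{i. D_proj i x \<noteq> (\<lambda>_. 0)}. D_proj i x)"
      using comp fin by (simp add: finsum_components) (simp add: D_proj_def)
  next
    fix f
    assume f: "(\<forall>i. f i \<in> D_component n i) \<and> finite {i. f i \<noteq> (\<lambda>_. 0)} \<and>
      x = (\<Oplus>\<^bsub>D_algebra n\<^esub>i\<in>{i. f i \<noteq> (\<lambda>_. 0)}. f i)"
    then have "x = (\<Oplus>\<^bsub>D_algebra n\<^esub>i\<in>{i. f i \<noteq> (\<lambda>_. 0)}. f i)" by blast
    also have "\<dots> = (\<lambda>b. f (D_degree b) b)"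
      using f by (intro finsum_components) blast+
    finally have x_eq: "x = (\<lambda>b. f (D_degree b) b)" .
    have comp: "f i \<in> D_component n i" for i using f by blast
    show "f = (\<lambda>i. D_proj i x)"
    proof (intro ext)
      fix i b
      show "f i b = D_proj i x b"
        using comp D_component_apply[of "f i" n i b]
        by (cases "D_degree b = i") (simp_all add: D_proj_def fun_cong[OF x_eq, of b])
    qed
  qed
  show "bracket (D_algebra n) x y \<in> D_component n (i + j)"
    if "x \<in> D_component n i" "y \<in> D_component n j" for x y i j
  proof -
    have "x a * y b * D_basis_bracket n a b c = 0" if "D_degree c \<noteq> i + j" for a b c
    proof (rule ccontr)
      assume nz: "x a * y b * D_basis_bracket n a b c \<noteq> 0"
      then have "D_degree c = D_degree a + D_degree b" by (auto dest: D_basis_bracket_nonzero)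
      with that have "D_degree a \<noteq> i \<or> D_degree b \<noteq> j" by blast
      with \<open>x \<in> D_component n i\<close> \<open>y \<in> D_component n j\<close> nz show False
        by (auto dest: D_component_apply)
    qed
    then have "bracket (D_algebra n) x y c = 0" if "D_degree c \<noteq> i + j" for c
      using that by (simp add: bracket_D_algebra)
    then show ?thesis
      using bracket_D_closed by (auto simp: D_component_def)
  qed
qed

section \<open>Cosets and the quotients of the descending central series\<close>

text \<open>For \<open>x\<close> in the carrier this is the coset of \<open>x\<close> modulo
  \<open>D_filtration n (Suc i)\<close>, written by coordinates so that equality of cosets means
  agreement in degrees up to \<open>i\<close>.\<close>

definition D_coset :: "nat \<Rightarrow> nat \<Rightarrow> (D_index \<Rightarrow> real) \<Rightarrow> (D_index \<Rightarrow> real) set" where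
  "D_coset n i x = {y \<in> carrier (D_algebra n). \<forall>b. D_degree b \<le> i \<longrightarrow> y b = x b}"

lemma D_coset_eq_iff:
  assumes "x \<in> carrier (D_algebra n)" "y \<in> carrier (D_algebra n)"
  shows "D_coset n i x = D_coset n i y \<longleftrightarrow> (\<forall>b. D_degree b \<le> i \<longrightarrow> x b = y b)"
proof
  assume "D_coset n i x = D_coset n i y"
  then have "x \<in> D_coset n i y" using assms by (auto simp: D_coset_def)
  then show "\<forall>b. D_degree b \<le> i \<longrightarrow> x b = y b" by (simp add: D_coset_def)
qed (auto simp: D_coset_def)

lemma D_coset_0: "D_coset n i (\<lambda>_. 0) = D_filtration n (Suc i)"
  by (auto simp: D_coset_def D_filtration_def)

lemma D_filtration_carrier: "x \<in> D_filtration n i \<Longrightarrow> x \<in> carrier (D_algebra n)"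
  by (simp add: D_filtration_def)

lemma a_r_coset_D_filtration:
  assumes "x \<in> carrier (D_algebra n)"
  shows "D_filtration n (Suc i) +>\<^bsub>D_algebra n\<^esub> x = D_coset n i x"
proof (intro equalityI subsetI)
  fix y assume y: "y \<in> D_coset n i x"
  define z where "z = (\<lambda>b. y b - x b)"
  have "z \<in> D_filtration n (Suc i)" "y = (\<lambda>b. z b + x b)"
    using y assms by (auto simp: D_coset_def D_filtration_def carrier_D_algebra z_def)
  then show "y \<in> D_filtration n (Suc i) +>\<^bsub>D_algebra n\<^esub> x"
    by (auto simp: a_r_coset_def')
qed (use assms in \<open>auto simp: a_r_coset_def' D_coset_def D_filtration_def carrier_D_algebra\<close>)

abbreviation D_quotient :: "nat \<Rightarrow> nat \<Rightarrow> (real, (D_index \<Rightarrow> real) set) module" where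
  "D_quotient n \<equiv> lcs_quotient (class_ring :: real ring) (D_algebra n)"

text \<open>Restricting the carrier in the record leaves addition unchanged, so cosets formed in a
  filtration term coincide with cosets formed in the whole algebra.\<close>

lemma carrier_D_quotient: "carrier (D_quotient n i) = D_coset n i ` D_filtration n i"
proof -
  have "D_filtration n (Suc i) +>\<^bsub>D_algebra n\<lparr>carrier := D_filtration n i\<rparr>\<^esub> x = D_coset n i x"
    if "x \<in> D_filtration n i" for x
    using a_r_coset_D_filtration[of x n i] that by (simp add: a_r_coset_def' D_filtration_carrier)
  then show ?thesis
    unfolding lcs_quotient_def quotient_space_def lower_central_D_algebra by (auto simp: A_RCOSETS_def')
qed

lemma zero_D_quotient: "\<zero>\<^bsub>D_quotient n i\<^esub> = D_coset n i (\<lambda>_. 0)"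
  unfolding lcs_quotient_def quotient_space_def lower_central_D_algebra by (simp add: D_coset_0)

lemma add_D_quotient:
  assumes "x \<in> carrier (D_algebra n)" "y \<in> carrier (D_algebra n)"
  shows "D_coset n i x \<oplus>\<^bsub>D_quotient n i\<^esub> D_coset n i y = D_coset n i (\<lambda>b. x b + y b)"
proof -
  have "D_coset n i x <+>\<^bsub>D_algebra n\<lparr>carrier := D_filtration n i\<rparr>\<^esub> D_coset n i y = D_coset n i (\<lambda>b. x b + y b)"
  proof (intro equalityI subsetI)
    fix z assume z: "z \<in> D_coset n i (\<lambda>b. x b + y b)"
    \<comment> \<open>To split \<open>z\<close>, the second summand is kept equal to
      \<open>y\<close> and the whole discrepancy goes into the first.\<close>
    define w where "w = (\<lambda>b. z b - y b)"
    have "w \<in> D_coset n i x" "y \<in> D_coset n i y" "z = (\<lambda>b. w b + y b)"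
      using z assms by (auto simp: D_coset_def carrier_D_algebra w_def)
    then show "z \<in> D_coset n i x <+>\<^bsub>D_algebra n\<lparr>carrier := D_filtration n i\<rparr>\<^esub> D_coset n i y"
      by (auto simp: set_add_def')
  qed (use assms in \<open>auto simp: set_add_def' D_coset_def carrier_D_algebra\<close>)
  then show ?thesis
    unfolding lcs_quotient_def quotient_space_def lower_central_D_algebra by simp
qed

lemma smult_D_quotient:
  assumes "x \<in> carrier (D_algebra n)"
  shows "c \<odot>\<^bsub>D_quotient n i\<^esub> D_coset n i x = D_coset n i (\<lambda>b. c * x b)"
proof -
  have "D_filtration n (Suc i) +>\<^bsub>D_algebra n\<lparr>carrier := D_filtration n i\<rparr>\<^esub> (\<lambda>b. c * y b) =
      D_coset n i (\<lambda>b. c * x b)" if "y \<in> D_coset n i x" for y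
  proof -
    have "D_filtration n (Suc i) +>\<^bsub>D_algebra n\<lparr>carrier := D_filtration n i\<rparr>\<^esub> (\<lambda>b. c * y b) =
        D_filtration n (Suc i) +>\<^bsub>D_algebra n\<^esub> (\<lambda>b. c * y b)"
      by (simp add: a_r_coset_def')
    also have "\<dots> = D_coset n i (\<lambda>b. c * y b)"
      using that by (intro a_r_coset_D_filtration) (simp add: D_coset_def carrier_D_algebra)
    also have "\<dots> = D_coset n i (\<lambda>b. c * x b)"
      using that by (auto simp: D_coset_def)
    finally show ?thesis .
  qed
  \<comment> \<open>All representatives give the same coset; the union collapses to it because there
    is at least one representative.\<close>
  moreover have "x \<in> D_coset n i x" using assms by (simp add: D_coset_def)
  ultimately have "(\<Union>y\<in>D_coset n i x. D_filtration n (Suc i) +>\<^bsub>D_algebra n\<lparr>carrier := D_filtration n i\<rparr>\<^esub> (\<lambda>b. c * y b)) =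
      D_coset n i (\<lambda>b. c * x b)" by blast
  then show ?thesis
    unfolding lcs_quotient_def quotient_space_def lower_central_D_algebra by simp
qed

text \<open>Independence of representatives: changing \<open>x\<close> in degrees above
  \<open>i\<close>, or \<open>y\<close> in degrees above \<open>j\<close>, affects the bracket only
  in degrees above \<open>i + j\<close>.\<close>

lemma bracket_D_quotient:
  assumes x: "x \<in> D_filtration n i" and y: "y \<in> D_filtration n j"
  shows "lcs_quotient_bracket (class_ring :: real ring) (D_algebra n) i j (D_coset n i x) (D_coset n j y) =
    D_coset n (i + j) (bracket (D_algebra n) x y)"
proof -
  have "bracket (D_algebra n) x' y' c = bracket (D_algebra n) x y c"
    if x': "x' \<in> D_coset n i x" and y': "y' \<in> D_coset n j y" and c: "D_degree c \<le> i + j" for x' y' c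
    unfolding bracket_D_algebra
  proof (intro sum.cong refl)
    fix a b
    \<comment> \<open>A nonzero structure constant forces the degrees of \<open>a\<close> and
      \<open>b\<close> to add up to at most \<open>i + j\<close>. Either one of them lies below its
      bound, where both sides vanish, or both are extremal, where the representatives agree.\<close>
    consider "D_basis_bracket n a b c = 0" | "D_degree a < i" | "D_degree b < j" | "D_degree a = i" "D_degree b = j"
      using c D_basis_bracket_nonzero(2)[of n a b c] by linarith
    then show "x' a * y' b * D_basis_bracket n a b c = x a * y b * D_basis_bracket n a b c"
      by cases (use x y x' y' in \<open>auto simp: D_coset_def D_filtration_def\<close>)
  qed
  then have "D_coset n (i + j) (bracket (D_algebra n) x' y') = D_coset n (i + j) (bracket (D_algebra n) x y)"
    if "x' \<in> D_coset n i x" "y' \<in> D_coset n j y" for x' y'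
    using that by (simp add: D_coset_eq_iff bracket_D_closed)
  moreover have "x \<in> D_coset n i x" "y \<in> D_coset n j y"
    using x y by (auto simp: D_coset_def D_filtration_def)
  ultimately have "(\<Union>x'\<in>D_coset n i x. \<Union>y'\<in>D_coset n j y. D_coset n (i + j) (bracket (D_algebra n) x' y')) =
      D_coset n (i + j) (bracket (D_algebra n) x y)" by blast
  then show ?thesis
    unfolding lcs_quotient_bracket_def lower_central_D_algebra a_r_coset_D_filtration[OF bracket_D_closed] .
qed

lemma D_filtration_add: "x \<in> D_filtration n i \<Longrightarrow> y \<in> D_filtration n i \<Longrightarrow> (\<lambda>b. x b + y b) \<in> D_filtration n i"
  by (simp add: D_filtration_def carrier_D_algebra)

lemma zero_in_carrier_D: "(\<lambda>_. 0) \<in> carrier (D_algebra n)"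
  by (simp add: carrier_D_algebra)

lemma add_in_carrier_D:
  "x \<in> carrier (D_algebra n) \<Longrightarrow> y \<in> carrier (D_algebra n) \<Longrightarrow> (\<lambda>b. x b + y b) \<in> carrier (D_algebra n)"
  by (simp add: carrier_D_algebra)

text \<open>This gives meaning to the finite sums of cosets that define the bracket of the
  associated graded algebra.\<close>

lemma abelian_monoid_D_quotient: "abelian_monoid (D_quotient n i)"
proof (rule abelian_monoidI)
  show "\<zero>\<^bsub>D_quotient n i\<^esub> \<in> carrier (D_quotient n i)"
    unfolding carrier_D_quotient zero_D_quotient by (auto simp: D_filtration_def carrier_D_algebra)
qed (auto simp: carrier_D_quotient zero_D_quotient add_D_quotient zero_in_carrier_D add_in_carrier_D D_filtration_carrier D_filtration_add add_ac)

lemma finsum_D_quotient: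
  assumes "finite A" "\<And>a. a \<in> A \<Longrightarrow> f a \<in> D_filtration n i"
  shows "(\<Oplus>\<^bsub>D_quotient n i\<^esub>a\<in>A. D_coset n i (f a)) = D_coset n i (\<lambda>b. \<Sum>a\<in>A. f a b)"
proof -
  interpret Q: abelian_monoid "D_quotient n i" by (rule abelian_monoid_D_quotient)
  \<comment> \<open>Membership of the partial sums in the filtration is carried through the
    induction, since adding the next coset needs a representative there.\<close>
  have "(\<Oplus>\<^bsub>D_quotient n i\<^esub>a\<in>A. D_coset n i (f a)) = D_coset n i (\<lambda>b. \<Sum>a\<in>A. f a b) \<and>
      (\<lambda>b. \<Sum>a\<in>A. f a b) \<in> D_filtration n i"
    using assms
  proof (induction A)
    case empty
    then show ?case by (simp add: zero_D_quotient D_filtration_def carrier_D_algebra)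
  next
    case (insert a A)
    have "f a \<in> D_filtration n i" "(\<lambda>b. \<Sum>a\<in>A. f a b) \<in> D_filtration n i"
      using insert by auto
    note this this[THEN D_filtration_carrier]
    with insert show ?case
      by (subst Q.finsum_insert) (auto simp: carrier_D_quotient add_D_quotient D_filtration_add)
  qed
  then show ?thesis by blast
qed

text \<open>The range \<open>{1..<k}\<close> loses nothing: basis degrees are at least 1, so two
  degrees adding up to \<open>k\<close> both lie strictly between 0 and \<open>k\<close>.\<close>

lemma D_proj_bracket:
  "D_proj k (bracket (D_algebra n) x y) =
     (\<lambda>c. \<Sum>i\<in>{1..<k}. bracket (D_algebra n) (D_proj i x) (D_proj (k - i) y) c)"
proof
  fix c
  have *: "(\<Sum>i\<in>{1..<k}. D_proj i x a * D_proj (k - i) y b * D_basis_bracket n a b c) =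
      (if D_degree c = k then x a * y b * D_basis_bracket n a b c else 0)"
    if ab: "a \<in> D_basis n" "b \<in> D_basis n" for a b
  proof -
    \<comment> \<open>For fixed \<open>a\<close> and \<open>b\<close> only
      \<open>i = D_degree a\<close> survives, and then homogeneity makes
      \<open>D_degree b = k - i\<close> equivalent to \<open>D_degree c = k\<close>.\<close>
    have "D_proj i x a * D_proj (k - i) y b * D_basis_bracket n a b c =
      (if i = D_degree a then if D_degree c = k then x a * y b * D_basis_bracket n a b c else 0 else 0)"
      if "i \<in> {1..<k}" for i
      using that D_basis_bracket_nonzero(2)[of n a b c]
      by (cases "D_basis_bracket n a b c = 0") (auto simp: D_proj_def)
    then have "(\<Sum>i\<in>{1..<k}. D_proj i x a * D_proj (k - i) y b * D_basis_bracket n a b c) =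
      (\<Sum>i\<in>{1..<k}. if i = D_degree a then if D_degree c = k then x a * y b * D_basis_bracket n a b c else 0 else 0)"
      by (intro sum.cong refl)
    also have "\<dots> = (if D_degree c = k then x a * y b * D_basis_bracket n a b c else 0)"
      using ab[THEN D_degree_basis(1)] D_basis_bracket_nonzero(2)[of n a b c]
      by (cases "D_basis_bracket n a b c = 0") (auto simp: sum.delta)
    finally show ?thesis .
  qed
  have "(\<Sum>i\<in>{1..<k}. bracket (D_algebra n) (D_proj i x) (D_proj (k - i) y) c) =
      (\<Sum>a\<in>D_basis n. \<Sum>b\<in>D_basis n. \<Sum>i\<in>{1..<k}. D_proj i x a * D_proj (k - i) y b * D_basis_bracket n a b c)"
    unfolding bracket_D_algebra by (subst sum.swap) (intro sum.cong refl sum.swap)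
  also have "\<dots> = (\<Sum>a\<in>D_basis n. \<Sum>b\<in>D_basis n.
      if D_degree c = k then x a * y b * D_basis_bracket n a b c else 0)"
    by (intro sum.cong refl *)
  also have "\<dots> = D_proj k (bracket (D_algebra n) x y) c"
    by (simp add: D_proj_def bracket_D_algebra)
  finally show "D_proj k (bracket (D_algebra n) x y) c =
      (\<Sum>i\<in>{1..<k}. bracket (D_algebra n) (D_proj i x) (D_proj (k - i) y) c)" ..
qed

section \<open>The isomorphism onto the associated graded algebra\<close>

definition D_gr :: "nat \<Rightarrow> (D_index \<Rightarrow> real) \<Rightarrow> nat \<Rightarrow> (D_index \<Rightarrow> real) set" where
  "D_gr n x = (\<lambda>i. D_coset n i (D_proj i x))"

abbreviation gr_D_algebra :: "nat \<Rightarrow> (real, nat \<Rightarrow> (D_index \<Rightarrow> real) set) lie_algebra" where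
  "gr_D_algebra n \<equiv> assoc_graded (class_ring :: real ring) (D_algebra n)"

lemma D_proj_carrier: "x \<in> carrier (D_algebra n) \<Longrightarrow> D_proj i x \<in> carrier (D_algebra n)"
  by (rule D_component_carrier[OF D_proj_component])

lemma D_proj_filtration: "x \<in> carrier (D_algebra n) \<Longrightarrow> D_proj i x \<in> D_filtration n i"
  using D_proj_component D_component_subset_filtration by blast

lemma D_gr_eq_zero_iff:
  assumes "x \<in> carrier (D_algebra n)"
  shows "D_gr n x i = \<zero>\<^bsub>D_quotient n i\<^esub> \<longleftrightarrow> (\<forall>b. D_degree b = i \<longrightarrow> x b = 0)"
  unfolding D_gr_def zero_D_quotient D_coset_eq_iff[OF D_proj_carrier[OF assms] zero_in_carrier_D]
  by (auto simp: D_proj_def)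

lemma D_gr_carrier:
  assumes x: "x \<in> carrier (D_algebra n)"
  shows "D_gr n x \<in> carrier (gr_D_algebra n)"
proof -
  have "{i. D_gr n x i \<noteq> \<zero>\<^bsub>D_quotient n i\<^esub>} \<subseteq> D_degree ` D_basis n"
    using x unfolding D_gr_eq_zero_iff[OF x] by (auto simp: carrier_D_algebra)
  then have "finite {i. D_gr n x i \<noteq> \<zero>\<^bsub>D_quotient n i\<^esub>}"
    by (rule finite_subset) simp
  moreover have "D_gr n x i \<in> carrier (D_quotient n i)" for i
    using D_proj_filtration[OF x] by (simp add: D_gr_def carrier_D_quotient)
  ultimately show ?thesis by (simp add: assoc_graded_def)
qed

text \<open>Coordinate \<open>b\<close> can be recovered from the coset in degree
  \<open>D_degree b\<close>, where agreement up to that degree includes \<open>b\<close>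
  itself.\<close>

lemma inj_on_D_gr: "inj_on (D_gr n) (carrier (D_algebra n))"
proof (intro inj_onI ext)
  fix x y b
  assume xy: "x \<in> carrier (D_algebra n)" "y \<in> carrier (D_algebra n)" and "D_gr n x = D_gr n y"
  then have "D_gr n x (D_degree b) = D_gr n y (D_degree b)" by simp
  then have "D_coset n (D_degree b) (D_proj (D_degree b) x) = D_coset n (D_degree b) (D_proj (D_degree b) y)"
    by (simp only: D_gr_def)
  then have "D_proj (D_degree b) x b = D_proj (D_degree b) y b"
    unfolding D_coset_eq_iff[OF xy[THEN D_proj_carrier]] by blast
  then show "x b = y b" by (simp add: D_proj_def)
qed

text \<open>Choose a representative \<open>g i\<close> of each coset and assemble the preimage along
  the diagonal, taking its degree i coordinates from \<open>g i\<close>. Since \<open>g i\<close>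
  vanishes below degree i, its coset depends only on those coordinates.\<close>

lemma D_gr_surj:
  assumes "F \<in> carrier (gr_D_algebra n)"
  shows "F \<in> D_gr n ` carrier (D_algebra n)"
proof -
  have "F i \<in> D_coset n i ` D_filtration n i" for i
    using assms by (simp add: assoc_graded_def carrier_D_quotient)
  then have "\<forall>i. \<exists>y. y \<in> D_filtration n i \<and> F i = D_coset n i y" by blast
  from choice[OF this] obtain g
    where g: "\<And>i. g i \<in> D_filtration n i" "\<And>i. F i = D_coset n i (g i)" by blast
  define x where "x = (\<lambda>b. g (D_degree b) b)"
  have x: "x \<in> carrier (D_algebra n)"
    using g(1) by (auto simp: x_def D_filtration_def carrier_D_algebra)
  have "D_gr n x i = F i" for i
    unfolding g(2) D_gr_def D_coset_eq_iff[OF D_proj_carrier[OF x] D_filtration_carrier[OF g(1)]]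
    using g(1)[of i] by (auto simp: D_proj_def x_def D_filtration_def)
  then show ?thesis using x by blast
qed

lemma D_gr_bracket:
  assumes xy: "x \<in> carrier (D_algebra n)" "y \<in> carrier (D_algebra n)"
  shows "D_gr n (bracket (D_algebra n) x y) = bracket (gr_D_algebra n) (D_gr n x) (D_gr n y)"
proof
  fix k
  let ?f = "\<lambda>i. bracket (D_algebra n) (D_proj i x) (D_proj (k - i) y)"
  have f: "?f i \<in> D_filtration n k"
    "lcs_quotient_bracket (class_ring :: real ring) (D_algebra n) i (k - i) (D_gr n x i) (D_gr n y (k - i)) =
      D_coset n k (?f i)" if "i \<in> {1..<k}" for i
    using that bracket_D_filtration[OF D_proj_filtration[OF xy(1), of i] D_proj_filtration[OF xy(2), of "k - i"]]
      bracket_D_quotient[OF D_proj_filtration[OF xy(1), of i] D_proj_filtration[OF xy(2), of "k - i"]]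
    by (simp_all add: D_gr_def)
  interpret Q: abelian_monoid "D_quotient n k" by (rule abelian_monoid_D_quotient)
  have "bracket (gr_D_algebra n) (D_gr n x) (D_gr n y) k =
      (\<Oplus>\<^bsub>D_quotient n k\<^esub>i\<in>{1..<k}. D_coset n k (?f i))"
    using f by (simp add: assoc_graded_def carrier_D_quotient cong: Q.finsum_cong)
  also have "\<dots> = D_coset n k (\<lambda>b. \<Sum>i\<in>{1..<k}. ?f i b)"
    using f(1) by (intro finsum_D_quotient) auto
  also have "\<dots> = D_gr n (bracket (D_algebra n) x y) k"
    by (simp add: D_gr_def D_proj_bracket)
  finally show "D_gr n (bracket (D_algebra n) x y) k = bracket (gr_D_algebra n) (D_gr n x) (D_gr n y) k" ..
qed

text \<open>By \<open>D_gr_eq_zero_iff\<close>, trivial cosets outside degree \<open>i\<close> mean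
  exactly that all coordinates outside degree \<open>i\<close> vanish.\<close>

lemma D_gr_image_component:
  "D_gr n ` D_component n i = assoc_graded_component (class_ring :: real ring) (D_algebra n) i"
proof (intro equalityI subsetI)
  fix F assume "F \<in> D_gr n ` D_component n i"
  then obtain x where "x \<in> D_component n i" "F = D_gr n x" by blast
  then show "F \<in> assoc_graded_component class_ring (D_algebra n) i"
    using D_gr_carrier[of x n] by (auto simp: assoc_graded_component_def D_gr_eq_zero_iff D_component_def)
next
  fix F assume F: "F \<in> assoc_graded_component class_ring (D_algebra n) i"
  then obtain x where x: "x \<in> carrier (D_algebra n)" "F = D_gr n x"
    using D_gr_surj unfolding assoc_graded_component_def by blast
  then have "x \<in> D_component n i"
    using F by (auto simp: assoc_graded_component_def D_gr_eq_zero_iff D_component_def)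
  then show "F \<in> D_gr n ` D_component n i" using x by blast
qed

lemma graded_lie_iso_D_gr:
  "graded_lie_iso (class_ring :: real ring) (D_algebra n) (D_component n)
     (gr_D_algebra n) (assoc_graded_component class_ring (D_algebra n)) (D_gr n)"
  unfolding graded_lie_iso_def
proof (intro conjI ballI allI)
  have "D_gr n (\<lambda>b. x b + y b) = (\<lambda>i. D_gr n x i \<oplus>\<^bsub>D_quotient n i\<^esub> D_gr n y i)"
    if "x \<in> carrier (D_algebra n)" "y \<in> carrier (D_algebra n)" for x y
  proof -
    have "D_proj i (\<lambda>b. x b + y b) = (\<lambda>b. D_proj i x b + D_proj i y b)" for i
      by (auto simp: D_proj_def)
    then show ?thesis
      using that by (simp add: D_gr_def add_D_quotient D_proj_carrier)
  qed
  moreover have "D_gr n (\<lambda>b. c * x b) = (\<lambda>i. c \<odot>\<^bsub>D_quotient n i\<^esub> D_gr n x i)"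
    if "x \<in> carrier (D_algebra n)" for c x
  proof -
    have "D_proj i (\<lambda>b. c * x b) = (\<lambda>b. c * D_proj i x b)" for i
      by (auto simp: D_proj_def)
    then show ?thesis
      using that by (simp add: D_gr_def smult_D_quotient D_proj_carrier)
  qed
  ultimately show "D_gr n \<in> LinearCombinations.module_hom class_ring (D_algebra n) (gr_D_algebra n)"
    using D_gr_carrier by (auto simp: LinearCombinations.module_hom_def) (simp_all add: assoc_graded_def)
  show "bij_betw (D_gr n) (carrier (D_algebra n)) (carrier (gr_D_algebra n))"
    using D_gr_carrier D_gr_surj inj_on_D_gr by (auto simp: bij_betw_def)
qed (simp_all add: D_gr_bracket D_gr_image_component)

lemma naturally_graded_D_algebra:
  assumes "1 \<le> n"
  shows "naturally_graded (class_ring :: real ring) (D_algebra n) (D_component n)"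
  unfolding naturally_graded_def
  using nilpotent_D_algebra[OF assms] graded_D_algebra graded_lie_iso_D_gr by blast

theorem proposition5p2:
  fixes n :: nat
  assumes "n \<ge> 1"
  shows "nilpotent_lie_algebra (class_ring :: real ring) (D_algebra n) \<and>
         naturally_graded (class_ring :: real ring) (D_algebra n) (D_component n) \<and>
         vectorspace.fin_dim (class_ring :: real ring) (D_algebra n) \<and>
         (\<forall>m. (n = 4 * m \<longrightarrow> vectorspace.dim (class_ring :: real ring) (D_algebra n) = 6 * m) \<and>
              (n = 4 * m + 1 \<longrightarrow> vectorspace.dim (class_ring :: real ring) (D_algebra n) = 6 * m + 2) \<and>
              (n = 4 * m + 2 \<longrightarrow> vectorspace.dim (class_ring :: real ring) (D_algebra n) = 6 * m + 3) \<and>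
              (n = 4 * m + 3 \<longrightarrow> vectorspace.dim (class_ring :: real ring) (D_algebra n) = 6 * m + 5)) \<and>
         nil_index (class_ring :: real ring) (D_algebra n) = n"
  using nilpotent_D_algebra[OF assms] naturally_graded_D_algebra[OF assms] fin_dim_D_algebra
    nil_index_D_algebra[OF assms]
  unfolding dim_D_algebra by auto

end
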